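(* Let $\mathcal{H},\mathcal{K}$ be Hilbert spaces, let $V\in\mathcal{B}(\mathcal{H})$ be an isometry, let $T\in\mathcal{B}(\mathcal{K})$ be a right invertible contraction, and for $Y\in\mathcal{B}(\mathcal{H},\mathcal{K})$ write $$R(Y)=\begin{bmatrix}T & Y\\ 0 & V\end{bmatrix}\in\mathcal{B}(\mathcal{K}\oplus\mathcal{H}),$$ so $R(0)=T\oplus V$. Let $X\in\mathcal{B}(\mathcal{H},\mathcal{K})$. Then $R(X)$ is similar to a contraction if and only if $R(X)$ is power bounded and there exist $A\in\mathcal{B}(\mathcal{H},\mathcal{K})$ and a nilpotent $E\in\mathcal{B}(\mathcal{K}\oplus\mathcal{H})$ with $ER(A)=0$ and $R(X)=R(A)+E$, such that $R(A)$ is quadratically near $R(0)$ modulo $\ker V^*$, i.e. there is a constant $s$ with $$\Big\|\sum_{n=0}^{N}\big(R(A)^n-R(0)^n\big)x_n\Big\|\le s\Big(\sum_{n=0}^N\|x_n\|^2\Big)^{1/2}$$ for every $N\in\mathbb{N}$ and all $x_0,\ldots,x_N\in\{0\}\oplus\ker V^*\subset\mathcal{K}\oplus\mathcal{H}$.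
   Context: An operator is power bounded if the norms of its powers are uniformly bounded; it is similar to a contraction if it is conjugate by an invertible operator to an operator of norm at most 1. *)

theory Defs
  imports "HOL-Analysis.Analysis"
begin

text \<open>Complex Hilbert spaces are modelled as real Hilbert spaces
  (real_inner + complete_space) equipped with an orthogonal complex structure J
  (multiplication by the imaginary unit): J o J = -id and J preserves the real
  inner product.  The complex inner product is then recovered as
  <x,y> = x \<bullet> y + i (x \<bullet> J y) (up to convention); norms agree.\<close>

definition complex_structure :: "('a::real_inner \<Rightarrow>\<^sub>L 'a) \<Rightarrow> bool" where
  "complex_structure J \<longleftrightarrow>
     J o\<^sub>L J = - id_blinfun \<and> (\<forall>x y. inner (J x) (J y) = inner x y)"

definition clinear_op ::
  "('a::real_normed_vector \<Rightarrow>\<^sub>L 'a) \<Rightarrow> ('b::real_normed_vector \<Rightarrow>\<^sub>L 'b) \<Rightarrow> ('a \<Rightarrow>\<^sub>L 'b) \<Rightarrow> bool" where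
  "clinear_op J1 J2 F \<longleftrightarrow> F o\<^sub>L J1 = J2 o\<^sub>L F"

definition sum_structure ::
  "('k::real_normed_vector \<Rightarrow>\<^sub>L 'k) \<Rightarrow> ('h::real_normed_vector \<Rightarrow>\<^sub>L 'h) \<Rightarrow> ('k \<times> 'h) \<Rightarrow>\<^sub>L ('k \<times> 'h)" where
  "sum_structure JK JH = Blinfun (\<lambda>z. (JK (fst z), JH (snd z)))"

definition bpow :: "('a::real_normed_vector \<Rightarrow>\<^sub>L 'a) \<Rightarrow> nat \<Rightarrow> ('a \<Rightarrow>\<^sub>L 'a)" where
  "bpow F n = ((\<lambda>G. F o\<^sub>L G) ^^ n) id_blinfun"

definition isometry :: "('a::real_normed_vector \<Rightarrow>\<^sub>L 'b::real_normed_vector) \<Rightarrow> bool" where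
  "isometry V \<longleftrightarrow> (\<forall>x. norm (V x) = norm x)"

definition contraction :: "('a::real_normed_vector \<Rightarrow>\<^sub>L 'b::real_normed_vector) \<Rightarrow> bool" where
  "contraction T \<longleftrightarrow> norm T \<le> 1"

definition power_bounded :: "('a::real_normed_vector \<Rightarrow>\<^sub>L 'a) \<Rightarrow> bool" where
  "power_bounded F \<longleftrightarrow> (\<exists>M. \<forall>n. norm (bpow F n) \<le> M)"

definition nilpotent_op :: "('a::real_normed_vector \<Rightarrow>\<^sub>L 'a) \<Rightarrow> bool" where
  "nilpotent_op E \<longleftrightarrow> (\<exists>n. bpow E n = 0)"

definition similar_to_contraction ::
  "('a::real_normed_vector \<Rightarrow>\<^sub>L 'a) \<Rightarrow> ('a \<Rightarrow>\<^sub>L 'a) \<Rightarrow> bool" where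
  "similar_to_contraction J F \<longleftrightarrow>
     (\<exists>S Si. clinear_op J J S \<and> clinear_op J J Si \<and>
        S o\<^sub>L Si = id_blinfun \<and> Si o\<^sub>L S = id_blinfun \<and>
        contraction (Si o\<^sub>L F o\<^sub>L S))"

definition Rmat ::
  "('k::real_normed_vector \<Rightarrow>\<^sub>L 'k) \<Rightarrow> ('h::real_normed_vector \<Rightarrow>\<^sub>L 'h) \<Rightarrow> ('h \<Rightarrow>\<^sub>L 'k)
     \<Rightarrow> ('k \<times> 'h) \<Rightarrow>\<^sub>L ('k \<times> 'h)" where
  "Rmat T V Y = Blinfun (\<lambda>z. (T (fst z) + Y (snd z), V (snd z)))"

end

theory Submission
  imports Defs
begin

text \<open>
  Both sides are equivalent to the solvability of \<open>Z V = T Z + X\<close>, since such a \<open>Z\<close> makes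
  \<open>[1, Z; 0, 1]\<close> conjugate \<open>R(X)\<close> to the contraction \<open>R(0)\<close>. A solution is obtained as a weak cluster
  point of the Cesaro means of any bounded sequence with \<open>W\<^bsub>n+1\<^esub> V = T W\<^bsub>n\<^esub> + X\<close>.

  If \<open>R(X)\<close> is a contraction for an equivalent Hilbert norm, let \<open>q\<close> be the quotient norm on \<open>H\<close> and
  \<open>d = c\<parallel>\<cdot>\<parallel>\<^sup>2 - q\<^sup>2\<close> with \<open>c\<close> large. Taking for \<open>B\<close> the left inverse of \<open>V\<close> that vanishes on the
  \<open>d\<close>-orthogonal complement of \<open>VH\<close>, the sequence \<open>W\<^bsub>n+1\<^esub> = (T W\<^bsub>n\<^esub> + X) B\<close> stays bounded by \<open>d\<close>;
  this is an explicit form of commutant lifting. Then \<open>A = X + T Z (1 - V V\<^sup>*)\<close> has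
  \<open>R(A)\<^sup>n - R(0)\<^sup>n = Z V\<^sup>n\<close> on \<open>ker V\<^sup>*\<close> for \<open>n \<ge> 1\<close>, and the spaces \<open>V\<^sup>n ker V\<^sup>*\<close> are mutually orthogonal.

  Conversely, \<open>E R(A) = 0\<close> means that \<open>X\<close> and \<open>A\<close> agree on the range of \<open>V\<close>. Quadratic nearness and
  power boundedness bound the analogous sequence for \<open>A\<close> with \<open>B = V\<^sup>*\<close>, by the Wold decomposition.
  A right inverse \<open>T\<^sub>r\<close> of \<open>T\<close> turns the resulting \<open>Z\<close> into the solution \<open>Z - T\<^sub>r (X - A)\<close> for \<open>X\<close>.
\<close>

section \<open>Riesz representation for symmetric coercive forms\<close>

text \<open>This is Riesz's theorem for the equivalent inner product \<open>a\<close>, by the direct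
  method: the energy \<open>a y y - 2 * f y\<close> is bounded below, its minimising sequences
  converge, and its first variation vanishes at the minimiser.\<close>

lemma coercive_form_represents:
  fixes a :: "'a::{real_inner,complete_space} \<Rightarrow> 'a \<Rightarrow> real"
  assumes a: "bounded_bilinear a" and sym: "\<And>x y. a x y = a y x"
    and c: "c > 0" and coercive: "\<And>x. c * (norm x)\<^sup>2 \<le> a x x"
    and f: "bounded_linear f"
  shows "\<exists>y. \<forall>v. a y v = f v"
proof -
  interpret a: bounded_bilinear a by (rule a)
  interpret f: bounded_linear f by (rule f)
  define \<phi> where "\<phi> y = a y y - 2 * f y" for y
  obtain F where F: "\<And>y. norm (f y) \<le> norm y * F" using f.nonneg_bounded by blast
  have low: "- F\<^sup>2 / c \<le> \<phi> y" for y
  proof -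
    have "0 \<le> c * (norm y - F / c)\<^sup>2" using c by simp
    also have "\<dots> = c * (norm y)\<^sup>2 - 2 * (norm y * F) + F\<^sup>2 / c"
      using c by (simp add: power2_eq_square field_simps)
    finally show ?thesis using coercive[of y] F[of y] unfolding \<phi>_def by simp
  qed
  define m where "m = Inf (range \<phi>)"
  have bdd: "bdd_below (range \<phi>)" using low by (intro bdd_belowI2[where m="- F\<^sup>2 / c"]) auto
  have m_le: "m \<le> \<phi> y" for y unfolding m_def using bdd by (intro cInf_lower) auto
  have "\<exists>y. \<phi> y < m + 1 / real (Suc n)" for n
    using cInf_lessD[of "range \<phi>" "m + 1 / real (Suc n)"] unfolding m_def by auto
  then obtain Y where Y: "\<And>n. \<phi> (Y n) < m + 1 / real (Suc n)" by metis
  \<comment> \<open>The parallelogram law: since the midpoint has energy at least \<open>m\<close>,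
    two nearly minimal points must be close to each other.\<close>
  have par: "a (x - y) (x - y) = 2 * \<phi> x + 2 * \<phi> y - 4 * \<phi> ((1/2) *\<^sub>R (x + y))" for x y
    unfolding \<phi>_def
    by (simp add: a.add_left a.add_right a.diff_left a.diff_right a.scaleR_left a.scaleR_right
        f.add f.scaleR sym[of y x] algebra_simps)
  have dist: "c * (norm (Y i - Y j))\<^sup>2 \<le> 2 / real (Suc i) + 2 / real (Suc j)" for i j
    using coercive[of "Y i - Y j"] par[of "Y i" "Y j"] Y[of i] Y[of j] m_le[of "(1/2) *\<^sub>R (Y i + Y j)"]
    by linarith
  have "Cauchy Y"
  proof (rule metric_CauchyI)
    fix e :: real assume e: "0 < e"
    have "c * e\<^sup>2 / 4 > 0" using c e by simp
    then obtain N where N: "inverse (real (Suc N)) < c * e\<^sup>2 / 4" using reals_Archimedean by blast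
    have "dist (Y i) (Y j) < e" if "i \<ge> N" "j \<ge> N" for i j
    proof -
      have "1 / real (Suc i) \<le> inverse (real (Suc N))" "1 / real (Suc j) \<le> inverse (real (Suc N))"
        using that by (auto simp: field_simps)
      then have "c * (norm (Y i - Y j))\<^sup>2 < c * e\<^sup>2" using dist[of i j] N by linarith
      then have "(norm (Y i - Y j))\<^sup>2 < e\<^sup>2" using c by simp
      then show ?thesis using e by (simp add: dist_norm power2_less_imp_less)
    qed
    then show "\<exists>M. \<forall>i\<ge>M. \<forall>j\<ge>M. dist (Y i) (Y j) < e" by blast
  qed
  then obtain y where y: "Y \<longlonglongrightarrow> y" using Cauchy_convergent_iff convergent_def by blast
  have "(\<lambda>n. \<phi> (Y n)) \<longlonglongrightarrow> \<phi> y" unfolding \<phi>_def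
    by (intro tendsto_intros a.tendsto f.tendsto y)
  moreover have "(\<lambda>n. m + 1 / real (Suc n)) \<longlonglongrightarrow> m + 0"
    by (intro tendsto_intros LIMSEQ_Suc lim_1_over_n)
  ultimately have min: "\<phi> y \<le> \<phi> z" for z
    using LIMSEQ_le[of "\<lambda>n. \<phi> (Y n)" "\<phi> y" _ m] Y m_le[of z] by (force intro: less_imp_le)
  have "a y v = f v" for v
  proof (cases "v = 0")
    case True then show ?thesis by (simp add: a.zero_right f.zero)
  next
    case False
    then have pos: "a v v > 0" using coercive[of v] c by (smt (verit) mult_pos_pos zero_less_norm_iff zero_less_power)
    define e where "e = a y v - f v"
    \<comment> \<open>This \<open>t\<close> minimises the quadratic polynomial given by the energy
      along the line through \<open>y\<close> in direction \<open>v\<close>.\<close>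
    define t where "t = - e / a v v"
    have "\<phi> (y + t *\<^sub>R v) - \<phi> y = t * (t * a v v) + 2 * t * e"
      unfolding \<phi>_def e_def
      by (simp add: a.add_left a.add_right a.scaleR_left a.scaleR_right f.add f.scaleR sym[of v y] algebra_simps)
    also have "\<dots> = - (e * e) / a v v" unfolding t_def using pos by (simp add: field_simps)
    finally have "0 \<le> - (e * e) / a v v" using min[of "y + t *\<^sub>R v"] by simp
    then have "e * e \<le> 0" using pos by (simp add: divide_le_0_iff)
    then show ?thesis unfolding e_def by (metis eq_iff_diff_eq_0 mult_eq_0_iff zero_le_square antisym)
  qed
  then show ?thesis by blast
qed

lemma coercive_form_inj:
  fixes a :: "'a::real_inner \<Rightarrow> 'a \<Rightarrow> real"
  assumes a: "bounded_bilinear a" and c: "c > 0" and coercive: "\<And>x. c * (norm x)\<^sup>2 \<le> a x x"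
    and eq: "\<And>v. a y v = a z v"
  shows "y = z"
proof -
  interpret a: bounded_bilinear a by (rule a)
  have "a (y - z) (y - z) = 0" by (simp add: a.diff_left eq)
  then show ?thesis using coercive[of "y - z"] c
    by (metis eq_iff_diff_eq_0 linorder_not_le mult_pos_pos zero_less_norm_iff zero_less_power)
qed

text \<open>Uniqueness of representatives makes the pointwise choice linear, and coercivity bounds
  it by \<open>K / c\<close>. This is the source of every operator below that is specified by a
  form: adjoints, weak limits, and the projections used for commutant lifting.\<close>

lemma coercive_form_represents_bilinear:
  fixes a :: "'a::{real_inner,complete_space} \<Rightarrow> 'a \<Rightarrow> real"
    and b :: "'b::real_normed_vector \<Rightarrow> 'a \<Rightarrow> real"
  assumes a: "bounded_bilinear a" and sym: "\<And>x y. a x y = a y x"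
    and c: "c > 0" and coercive: "\<And>x. c * (norm x)\<^sup>2 \<le> a x x"
    and b: "bounded_bilinear b"
  shows "\<exists>B :: 'b \<Rightarrow>\<^sub>L 'a. \<forall>x v. a (B x) v = b x v"
proof -
  interpret a: bounded_bilinear a by (rule a)
  interpret b: bounded_bilinear b by (rule b)
  have "\<exists>y. \<forall>v. a y v = b x v" for x
    by (rule coercive_form_represents[OF a sym c coercive b.bounded_linear_right])
  then obtain B where B: "\<And>x v. a (B x) v = b x v" by metis
  note inj = coercive_form_inj[OF a c coercive]
  obtain K where K: "\<And>x v. norm (b x v) \<le> norm x * norm v * K" and K0: "0 \<le> K"
    using b.nonneg_bounded by blast
  have "bounded_linear B"
  proof (rule bounded_linear_intro[where K = "K / c"])
    show "B (x + y) = B x + B y" for x y by (rule inj) (simp add: B a.add_left b.add_left)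
    show "B (r *\<^sub>R x) = r *\<^sub>R B x" for r x by (rule inj) (simp add: B a.scaleR_left b.scaleR_left)
    show "norm (B x) \<le> norm x * (K / c)" for x
    proof (cases "B x = 0")
      case False
      have "c * (norm (B x))\<^sup>2 \<le> norm x * norm (B x) * K"
        using coercive[of "B x"] K[of x "B x"] by (simp add: B)
      then have "norm (B x) * (c * norm (B x)) \<le> norm (B x) * (norm x * K)"
        by (simp add: power2_eq_square mult_ac)
      then have "c * norm (B x) \<le> norm x * K" using False by simp
      then show ?thesis using c by (simp add: field_simps)
    qed (use K0 c in simp)
  qed
  then show ?thesis using B by (intro exI[of _ "Blinfun B"]) (simp add: bounded_linear_Blinfun_apply)
qed

section \<open>Weak operator compactness and adjoints\<close>

text \<open>By Tychonoff's theorem the families of matrix entries \<open>C n x \<bullet> y\<close>,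
  which lie in a product of compact intervals, have a cluster point. It is again a bounded bilinear
  form, hence comes from an operator.\<close>

lemma bounded_operators_weak_cluster:
  fixes C :: "nat \<Rightarrow> 'h::real_normed_vector \<Rightarrow>\<^sub>L 'k::{real_inner,complete_space}"
  assumes M: "\<And>n. norm (C n) \<le> M"
  shows "\<exists>F (Z :: 'h \<Rightarrow>\<^sub>L 'k). F \<noteq> bot \<and> F \<le> sequentially \<and>
    (\<forall>x y. ((\<lambda>n. C n x \<bullet> y) \<longlongrightarrow> Z x \<bullet> y) F)"
proof -
  have bd: "\<bar>C n x \<bullet> y\<bar> \<le> norm x * norm y * M" for n x y
  proof -
    have "\<bar>C n x \<bullet> y\<bar> \<le> norm (C n x) * norm y" by (rule Cauchy_Schwarz_ineq2)
    also have "\<dots> \<le> (M * norm x) * norm y"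
      by (intro mult_right_mono order_trans[OF norm_blinfun mult_right_mono] M) auto
    finally show ?thesis by (simp add: mult_ac)
  qed
  define S where "S = (\<Pi>\<^sub>E p\<in>UNIV. {- (norm (fst p) * norm (snd p) * M) .. norm (fst p :: 'h) * norm (snd p :: 'k) * M})"
  define f where "f n = (\<lambda>p. C n (fst p) \<bullet> snd p)" for n
  have "compactin (product_topology (\<lambda>p. euclidean) UNIV) S"
    unfolding S_def compactin_PiE by auto
  then have "compact S" by (simp add: euclidean_product_topology)
  moreover have "f n \<in> S" for n
    unfolding S_def f_def using bd by (auto simp: abs_le_iff minus_le_iff)
  ultimately obtain g where g: "g \<in> S" "inf (nhds g) (filtermap f sequentially) \<noteq> bot"
    unfolding compact_filter
    by (metis (no_types, lifting) eventually_filtermap always_eventually filtermap_bot_iff sequentially_bot)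
  \<comment> \<open>A filter stands in for the subnet along which \<open>f\<close> converges to its cluster point \<open>g\<close>.\<close>
  define F where "F = inf sequentially (filtercomap f (nhds g))"
  have F: "F \<noteq> bot"
  proof
    assume "F = bot"
    then have "eventually (\<lambda>_. False) (inf sequentially (filtercomap f (nhds g)))"
      unfolding F_def by simp
    then obtain P Q where P: "eventually P sequentially" and Q: "eventually Q (nhds g)"
      and PQ: "\<And>n. P n \<Longrightarrow> Q (f n) \<Longrightarrow> False"
      unfolding eventually_inf eventually_filtercomap by blast
    have "eventually (\<lambda>z. \<not> Q z) (filtermap f sequentially)"
      unfolding eventually_filtermap by (rule eventually_mono[OF P]) (use PQ in blast)
    with Q have "eventually (\<lambda>_. False) (inf (nhds g) (filtermap f sequentially))"
      unfolding eventually_inf by blast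
    then show False using g(2) by (simp add: trivial_limit_def)
  qed
  have "filterlim f (nhds g) F"
    unfolding F_def by (meson filterlim_filtercomap filterlim_inf filterlim_mono inf_le2 order_refl)
  then have "((\<lambda>n. f n p) \<longlongrightarrow> g p) F" for p
    using continuous_on_tendsto_compose[OF continuous_on_product_coordinates[of p], of f g F] by simp
  then have lim: "((\<lambda>n. C n x \<bullet> y) \<longlongrightarrow> g (x, y)) F" for x y
    unfolding f_def by force
  have gb: "\<bar>g (x, y)\<bar> \<le> norm x * norm y * M" for x y
    using g(1) unfolding S_def by (auto simp: PiE_iff abs_le_iff minus_le_iff)
  have "bounded_bilinear (\<lambda>x y. g (x, y))"
  proof
    show "g (x + x', y) = g (x, y) + g (x', y)" for x x' y
      by (rule tendsto_unique[OF F lim]) (simp add: blinfun.add_right inner_add_left tendsto_add lim)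
    show "g (x, y + y') = g (x, y) + g (x, y')" for x y y'
      by (rule tendsto_unique[OF F lim]) (simp add: inner_add_right tendsto_add lim)
    show "g (r *\<^sub>R x, y) = r *\<^sub>R g (x, y)" for r x y
      by (rule tendsto_unique[OF F lim]) (simp add: blinfun.scaleR_right tendsto_mult_left lim)
    show "g (x, r *\<^sub>R y) = r *\<^sub>R g (x, y)" for r x y
      by (rule tendsto_unique[OF F lim]) (simp add: tendsto_mult_left lim)
    show "\<exists>K. \<forall>x y. norm (g (x, y)) \<le> norm x * norm y * K" using gb by auto
  qed
  from coercive_form_represents_bilinear[OF bounded_bilinear_inner inner_commute, of 1, OF _ _ this]
  obtain Z :: "'h \<Rightarrow>\<^sub>L 'k" where "\<And>x y. Z x \<bullet> y = g (x, y)"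
    by (auto simp: power2_norm_eq_inner)
  then show ?thesis using F lim unfolding F_def
    by (intro exI[of _ F] exI[of _ Z]) (auto simp: F_def)
qed

lemma blinfun_has_adjoint:
  fixes F :: "'a::{real_inner,complete_space} \<Rightarrow>\<^sub>L 'b::real_inner"
  shows "\<exists>G :: 'b \<Rightarrow>\<^sub>L 'a. \<forall>x y. F x \<bullet> y = x \<bullet> G y"
proof -
  have "bounded_bilinear (\<lambda>y x. y \<bullet> F x)"
    by (rule bounded_bilinear.comp[OF bounded_bilinear_inner bounded_linear_ident blinfun.bounded_linear_right])
  from coercive_form_represents_bilinear[OF bounded_bilinear_inner inner_commute, of 1, OF _ _ this]
  obtain G :: "'b \<Rightarrow>\<^sub>L 'a" where "\<And>y x. G y \<bullet> x = y \<bullet> F x"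
    by (auto simp: power2_norm_eq_inner)
  then show ?thesis by (metis inner_commute)
qed

section \<open>Complex structures and complex-linear operators\<close>

lemma complex_structure_involution: "complex_structure J \<Longrightarrow> J (J x) = - x"
  unfolding complex_structure_def
  by (metis blinfun_apply_blinfun_compose blinfun_apply_id_blinfun blinfun.minus_left)

lemma complex_structure_isometric: "complex_structure J \<Longrightarrow> J x \<bullet> J y = x \<bullet> y"
  unfolding complex_structure_def by blast

lemma complex_structure_skew: "complex_structure J \<Longrightarrow> J x \<bullet> y = - (x \<bullet> J y)"
  by (metis complex_structure_involution complex_structure_isometric inner_minus_right minus_minus)

lemma clinear_op_iff: "clinear_op J1 J2 F \<longleftrightarrow> (\<forall>x. F (J1 x) = J2 (F x))"
  unfolding clinear_op_def by (metis blinfun_apply_blinfun_compose blinfun_eqI)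

text \<open>Every vector has the form \<open>J w\<close>, so invariance of both forms shows that
  \<open>B (J' x)\<close> and \<open>J (B x)\<close> represent the same functional.\<close>

lemma clinear_op_form_representative:
  fixes a :: "'a::real_inner \<Rightarrow> 'a \<Rightarrow> real"
  assumes a: "bounded_bilinear a" and c: "c > 0" and coercive: "\<And>x. c * (norm x)\<^sup>2 \<le> a x x"
    and J: "complex_structure J" and aJ: "\<And>x y. a (J x) (J y) = a x y"
    and bJ: "\<And>x y. b (blinfun_apply J' x) (J y) = b x y"
    and B: "\<And>x v. a (blinfun_apply B x) v = b x v"
  shows "clinear_op J' J B"
  unfolding clinear_op_iff
proof (intro allI coercive_form_inj[OF a c coercive])
  fix x v
  have v: "v = J (J (- v))" by (simp add: complex_structure_involution[OF J])
  show "a (B (J' x)) v = a (J (B x)) v"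
    by (subst (1 2) v) (simp only: aJ B bJ)
qed

lemma clinear_op_adjoint:
  fixes F :: "'a::real_inner \<Rightarrow>\<^sub>L 'b::real_inner"
  assumes JA: "complex_structure JA" and JB: "complex_structure JB" and F: "clinear_op JA JB F"
    and G: "\<And>x y. F x \<bullet> y = x \<bullet> blinfun_apply G y"
  shows "clinear_op JB JA G"
  unfolding clinear_op_iff
proof (intro allI)
  fix y
  have "x \<bullet> G (JB y) = x \<bullet> JA (G y)" for x
    using F complex_structure_skew[OF JA, of x "G y"] complex_structure_skew[OF JB, of "F x" y]
    by (simp add: clinear_op_iff flip: G)
  then show "G (JB y) = JA (G y)" by (metis inner_commute vector_eq_ldot)
qed

lemma clinear_op_zero: "clinear_op J1 J2 0"
  and clinear_op_id: "clinear_op J1 J1 id_blinfun"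
  and clinear_op_add: "clinear_op J1 J2 F \<Longrightarrow> clinear_op J1 J2 G \<Longrightarrow> clinear_op J1 J2 (F + G)"
  and clinear_op_diff: "clinear_op J1 J2 F \<Longrightarrow> clinear_op J1 J2 G \<Longrightarrow> clinear_op J1 J2 (F - G)"
  and clinear_op_scaleR: "clinear_op J1 J2 F \<Longrightarrow> clinear_op J1 J2 (r *\<^sub>R F)"
  and clinear_op_compose: "clinear_op J2 J3 E \<Longrightarrow> clinear_op J1 J2 F \<Longrightarrow> clinear_op J1 J3 (E o\<^sub>L F)"
  by (simp_all add: clinear_op_iff blinfun.bilinear_simps)

lemma clinear_op_sum: "(\<And>i. i \<in> I \<Longrightarrow> clinear_op J1 J2 (F i)) \<Longrightarrow> clinear_op J1 J2 (\<Sum>i\<in>I. F i)"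
  by (induction I rule: infinite_finite_induct) (auto intro: clinear_op_zero clinear_op_add)

lemma bpow_0 [simp]: "bpow F 0 = id_blinfun"
  and bpow_Suc: "bpow F (Suc n) = F o\<^sub>L bpow F n"
  by (simp_all add: bpow_def)

lemma bpow_Suc_right: "bpow F (Suc n) x = bpow F n (F x)"
  by (induction n) (simp_all add: bpow_Suc)

lemma clinear_op_bpow: "clinear_op J J F \<Longrightarrow> clinear_op J J (bpow F n)"
  by (induction n) (auto simp: bpow_Suc intro: clinear_op_id clinear_op_compose)

lemmas clinear_op_intros = clinear_op_zero clinear_op_id clinear_op_add clinear_op_diff
  clinear_op_scaleR clinear_op_compose clinear_op_sum clinear_op_bpow

section \<open>Solving \<open>Z V = T Z + A\<close> from bounded iterations\<close>

text \<open>Averaging telescopes: the Cesaro mean \<open>C n\<close> solves the equation up to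
  \<open>(W 0 - W (Suc n)) V / (n + 1)\<close>, which tends to zero because \<open>W\<close> is
  bounded.\<close>

lemma intertwiner_of_bounded_iterates:
  fixes W :: "nat \<Rightarrow> 'h::real_normed_vector \<Rightarrow>\<^sub>L 'k::{real_inner,complete_space}"
  assumes M: "\<And>n. norm (W n) \<le> M"
    and step: "\<And>n x. W (Suc n) (blinfun_apply V x) = blinfun_apply T (W n x) + blinfun_apply A x"
    and JK: "complex_structure JK" and W: "\<And>n. clinear_op JH JK (W n)"
  shows "\<exists>Z. clinear_op JH JK Z \<and> (\<forall>x. Z (blinfun_apply V x) = blinfun_apply T (Z x) + blinfun_apply A x)"
proof -
  define C where "C n = (1 / real (Suc n)) *\<^sub>R (\<Sum>i\<le>n. W i)" for n
  have "norm (C n) \<le> M" for n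
  proof -
    have "norm (\<Sum>i\<le>n. W i) \<le> real (Suc n) * M"
      using sum_norm_bound[of "{..n}" W M] M by simp
    then show ?thesis by (simp add: C_def field_simps)
  qed
  from bounded_operators_weak_cluster[of C, OF this] obtain F Z where F: "F \<noteq> bot" "F \<le> sequentially"
    and Z: "\<And>x y. ((\<lambda>n. C n x \<bullet> y) \<longlongrightarrow> blinfun_apply Z x \<bullet> y) F" by blast
  \<comment> \<open>Moving \<open>T\<close> to the other side of the inner product lets it pass
    through a weak limit.\<close>
  obtain T' where T': "\<And>x y. T x \<bullet> y = x \<bullet> blinfun_apply T' y" using blinfun_has_adjoint[of T] by blast
  have C: "clinear_op JH JK (C n)" for n unfolding C_def by (rule clinear_op_intros W)+
  have "clinear_op JH JK Z" unfolding clinear_op_iff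
  proof (intro allI)
    fix x
    have "Z (JH x) \<bullet> y = JK (Z x) \<bullet> y" for y
    proof (rule tendsto_unique[OF F(1) Z])
      show "((\<lambda>n. C n (JH x) \<bullet> y) \<longlongrightarrow> JK (Z x) \<bullet> y) F"
        using C by (simp add: clinear_op_iff complex_structure_skew[OF JK] tendsto_minus Z)
    qed
    then show "Z (JH x) = JK (Z x)" by (metis vector_eq_rdot)
  qed
  moreover have "Z (V x) = T (Z x) + A x" for x
  proof -
    have "Z (V x) \<bullet> y = (T (Z x) + A x) \<bullet> y" for y
    proof (rule tendsto_unique[OF F(1) Z])
      define r where "r n = (1 / real (Suc n)) * ((W 0 (V x) - W (Suc n) (V x)) \<bullet> y)" for n
      have C_eq: "C n (V x) \<bullet> y = C n x \<bullet> T' y + A x \<bullet> y + r n" for n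
      proof -
        have "(\<Sum>i\<le>n. W i (V x)) = (\<Sum>i\<le>n. W (Suc i) (V x)) + (W 0 (V x) - W (Suc n) (V x))"
          by (induction n) simp_all
        also have "(\<Sum>i\<le>n. W (Suc i) (V x)) = T (\<Sum>i\<le>n. W i x) + real (Suc n) *\<^sub>R A x"
          by (simp add: step sum.distrib blinfun.sum_right sum_constant_scaleR)
        finally have "C n (V x) = T (C n x) + A x + (1 / real (Suc n)) *\<^sub>R (W 0 (V x) - W (Suc n) (V x))"
          by (simp add: C_def blinfun.sum_left blinfun.scaleR_left blinfun.scaleR_right scaleR_right_distrib)
        then show ?thesis by (simp add: r_def inner_add_left T')
      qed
      have "norm (r n) \<le> (1 / real (Suc n)) * (2 * M * norm (V x) * norm y)" for n
      proof -
        have b: "norm (W i (V x)) \<le> M * norm (V x)" for i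
          by (rule order_trans[OF norm_blinfun mult_right_mono[OF M]]) simp
        have "\<bar>(W 0 (V x) - W (Suc n) (V x)) \<bullet> y\<bar> \<le> norm (W 0 (V x) - W (Suc n) (V x)) * norm y"
          by (rule Cauchy_Schwarz_ineq2)
        also have "\<dots> \<le> (2 * M * norm (V x)) * norm y"
          using norm_triangle_ineq4[of "W 0 (V x)" "W (Suc n) (V x)"] b[of 0] b[of "Suc n"]
          by (intro mult_right_mono) auto
        finally show ?thesis unfolding r_def by (simp add: abs_mult divide_right_mono)
      qed
      moreover have "(\<lambda>n. (1 / real (Suc n)) * (2 * M * norm (V x) * norm y)) \<longlonglongrightarrow> 0 * (2 * M * norm (V x) * norm y)"
        by (intro tendsto_intros LIMSEQ_Suc lim_1_over_n)
      ultimately have "r \<longlonglongrightarrow> 0"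
        by (intro Lim_null_comparison[of r]) (auto intro: always_eventually)
      then have "(r \<longlongrightarrow> 0) F" using F(2) by (rule tendsto_mono[rotated])
      then have "((\<lambda>n. C n x \<bullet> T' y + A x \<bullet> y + r n) \<longlongrightarrow> Z x \<bullet> T' y + A x \<bullet> y + 0) F"
        by (intro tendsto_intros Z)
      then show "((\<lambda>n. C n (V x) \<bullet> y) \<longlongrightarrow> (T (Z x) + A x) \<bullet> y) F"
        by (simp add: C_eq inner_add_left T')
    qed
    then show ?thesis by (metis vector_eq_rdot)
  qed
  ultimately show ?thesis by blast
qed

lemma isometry_inner:
  fixes V :: "'a::real_inner \<Rightarrow>\<^sub>L 'b::real_inner"
  assumes "isometry V" shows "V x \<bullet> V y = x \<bullet> y"
  using assms unfolding isometry_def dot_norm by (metis blinfun.add_right)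

text \<open>When \<open>B\<close> is a left inverse of \<open>V\<close>, composing with
  \<open>V\<close> cancels \<open>B\<close> and leaves \<open>T W + X\<close>, the recursion
  required for the Cesaro argument.\<close>

primrec intertwiner_iterate ::
  "('k::real_normed_vector \<Rightarrow>\<^sub>L 'k) \<Rightarrow> ('h::real_normed_vector \<Rightarrow>\<^sub>L 'k) \<Rightarrow> ('h \<Rightarrow>\<^sub>L 'h) \<Rightarrow> nat \<Rightarrow> 'h \<Rightarrow>\<^sub>L 'k" where
  "intertwiner_iterate T X B 0 = 0"
| "intertwiner_iterate T X B (Suc n) = ((T o\<^sub>L intertwiner_iterate T X B n) + X) o\<^sub>L B"

text \<open>The hypothesis \<open>dom\<close> says that \<open>[T, X; 0, V]\<close> is a contraction for the norm with square \<open>p k + q h h\<close>.\<close>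

lemma intertwiner_of_dominated_corner:
  fixes V :: "'h::{real_inner,complete_space} \<Rightarrow>\<^sub>L 'h" and T :: "'k::{real_inner,complete_space} \<Rightarrow>\<^sub>L 'k"
    and q :: "'h \<Rightarrow> 'h \<Rightarrow> real" and p :: "'k \<Rightarrow> real"
  assumes JK: "complex_structure JK" and JH: "complex_structure JH"
    and V: "clinear_op JH JH V" "isometry V" and T: "clinear_op JK JK T" and X: "clinear_op JH JK X"
    and q: "bounded_bilinear q" and q_sym: "\<And>x y. q x y = q y x"
    and q_J: "\<And>x y. q (JH x) (JH y) = q x y"
    and c: "c > 0" and p: "\<And>k. c * (norm k)\<^sup>2 \<le> p k" and p0: "p 0 = 0"
    and dom: "\<And>h k. p (T k + blinfun_apply X h) + q (V h) (V h) \<le> q h h + p k"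
  shows "\<exists>Z. clinear_op JH JK Z \<and> (\<forall>x. Z (V x) = T (blinfun_apply Z x) + X x)"
proof -
  interpret q: bounded_bilinear q by (rule q)
  obtain K where K: "\<And>x y. norm (q x y) \<le> norm x * norm y * K" and K0: "K \<ge> 0"
    using q.nonneg_bounded by blast
  \<comment> \<open>The factor \<open>K + 1\<close> exceeds the bound \<open>K\<close> of
    \<open>q\<close> by one, so that \<open>d\<close> is coercive with constant 1.\<close>
  define d where "d x y = (K + 1) * (x \<bullet> y) - q x y" for x y
  have d: "bounded_bilinear d" unfolding d_def
  proof
    show "\<exists>L. \<forall>a b. norm ((K + 1) * (a \<bullet> b) - q a b) \<le> norm a * norm b * L"
    proof (intro exI allI)
      fix a b :: 'h
      have "norm ((K + 1) * (a \<bullet> b) - q a b) \<le> (K + 1) * \<bar>a \<bullet> b\<bar> + norm (q a b)"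
        using norm_triangle_ineq4[of "(K + 1) * (a \<bullet> b)" "q a b"] K0 by (simp add: abs_mult)
      also have "\<dots> \<le> (K + 1) * (norm a * norm b) + norm a * norm b * K"
        using K0 by (intro add_mono mult_left_mono Cauchy_Schwarz_ineq2 K) auto
      finally show "norm ((K + 1) * (a \<bullet> b) - q a b) \<le> norm a * norm b * (2 * K + 1)"
        by (simp add: algebra_simps)
    qed
  qed (simp_all add: q.add_left q.add_right q.scaleR_left q.scaleR_right inner_add_left inner_add_right algebra_simps)
  interpret d: bounded_bilinear d by (rule d)
  have d_sym: "d x y = d y x" for x y unfolding d_def by (simp add: q_sym inner_commute)
  have d_J: "d (JH x) (JH y) = d x y" for x y
    unfolding d_def by (simp add: q_J complex_structure_isometric[OF JH])
  have d_low: "(norm x)\<^sup>2 \<le> d x x" for x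
    using K[of x x] unfolding d_def by (simp add: power2_norm_eq_inner algebra_simps flip: power2_eq_square)
  have d_up: "d x x \<le> (2 * K + 1) * (norm x)\<^sup>2" for x
    using K[of x x] unfolding d_def by (simp add: power2_norm_eq_inner algebra_simps flip: power2_eq_square)
  define a where "a x y = d (V x) (V y)" for x y
  have a: "bounded_bilinear a" unfolding a_def
    by (rule d.comp; rule blinfun.bounded_linear_right)
  have a_low: "1 * (norm x)\<^sup>2 \<le> a x x" for x
    using d_low[of "V x"] V(2) unfolding a_def isometry_def by simp
  have VJ: "V (JH x) = JH (V x)" for x using V(1) by (simp add: clinear_op_iff)
  have b: "bounded_bilinear (\<lambda>x y. d x (V y))"
    by (rule d.comp[OF bounded_linear_ident blinfun.bounded_linear_right])
  \<comment> \<open>By this identity \<open>V B\<close> is the \<open>d\<close>-orthogonal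
    projection onto the range of \<open>V\<close>.\<close>
  obtain B :: "'h \<Rightarrow>\<^sub>L 'h" where B: "\<And>x v. a (B x) v = d x (V v)"
    using coercive_form_represents_bilinear[OF a _ zero_less_one a_low b] d_sym unfolding a_def by blast
  have BJ: "clinear_op JH JH B"
    by (rule clinear_op_form_representative[OF a zero_less_one a_low JH _ _ B])
      (simp_all add: a_def VJ d_J)
  have BV: "B (V x) = x" for x
    by (rule coercive_form_inj[OF a zero_less_one a_low]) (simp add: B, simp add: a_def)
  \<comment> \<open>A \<open>d\<close>-orthogonal projection does not increase \<open>d\<close>.
    Since \<open>V\<close> preserves the ambient inner product, replacing \<open>V (B x)\<close> by
    \<open>B x\<close> changes \<open>d\<close> only through its \<open>q\<close> part.\<close>
  have defect: "q (B x) (B x) - q (V (B x)) (V (B x)) \<le> d x x - d (B x) (B x)" for x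
  proof -
    have "0 \<le> d (x - V (B x)) (x - V (B x))" using d_low order_trans zero_le_power2 by blast
    also have "\<dots> = d x x - d (V (B x)) (V (B x))"
      using B[of x "B x"] by (simp add: a_def d.diff_left d.diff_right d_sym[of "V (B x)" x])
    also have "d (V (B x)) (V (B x)) = d (B x) (B x) + q (B x) (B x) - q (V (B x)) (V (B x))"
      unfolding d_def by (simp add: isometry_inner[OF V(2)])
    finally show ?thesis by simp
  qed
  define W where "W = intertwiner_iterate T X B"
  \<comment> \<open>The bound reproduces itself: \<open>dom\<close> costs at most the
    \<open>q\<close>-defect at \<open>B x\<close>, and \<open>defect\<close> pays for it with the
    loss from \<open>d x x\<close> to \<open>d (B x) (B x)\<close>.\<close>
  have p_W: "p (W n x) \<le> d x x" for n x
  proof (induction n arbitrary: x)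
    case 0
    then show ?case using d_low[of x] by (simp add: W_def p0) (smt (verit) zero_le_power2)
  next
    case (Suc n)
    have "p (W (Suc n) x) = p (T (W n (B x)) + X (B x))" by (simp add: W_def blinfun.add_left)
    then show ?case using dom[of "W n (B x)" "B x"] defect[of x] Suc[of "B x"] by linarith
  qed
  define M where "M = sqrt ((2 * K + 1) / c)"
  have M: "norm (W n) \<le> M" for n
  proof (rule norm_blinfun_bound)
    show "0 \<le> M" using K0 c by (simp add: M_def)
    fix x
    have "c * (norm (W n x))\<^sup>2 \<le> (2 * K + 1) * (norm x)\<^sup>2"
      using p[of "W n x"] p_W[of n x] d_up[of x] by linarith
    then have "(norm (W n x))\<^sup>2 \<le> (2 * K + 1) / c * (norm x)\<^sup>2" using c by (simp add: field_simps)
    then have "norm (W n x) \<le> sqrt ((2 * K + 1) / c * (norm x)\<^sup>2)" by (rule real_le_rsqrt)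
    then show "norm (W n x) \<le> M * norm x" by (simp only: real_sqrt_mult M_def real_sqrt_abs abs_norm_cancel)
  qed
  have W: "clinear_op JH JK (W n)" for n
    unfolding W_def by (induction n) (auto intro: clinear_op_intros BJ T X)
  show ?thesis
    by (rule intertwiner_of_bounded_iterates[of W, OF M _ JK W]) (simp add: W_def BV blinfun.add_left)
qed

section \<open>Block triangular operators and similarity\<close>

lemma Rmat_apply: "Rmat T V Y z = (T (fst z) + Y (snd z), V (snd z))"
proof -
  have "bounded_linear (\<lambda>z. (T (fst z) + Y (snd z), V (snd z)))"
    by (intro bounded_linear_intros)
  then show ?thesis unfolding Rmat_def by (simp add: bounded_linear_Blinfun_apply)
qed

lemma sum_structure_apply: "sum_structure JK JH z = (JK (fst z), JH (snd z))"
proof -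
  have "bounded_linear (\<lambda>z. (JK (fst z), JH (snd z)))"
    by (intro bounded_linear_intros)
  then show ?thesis unfolding sum_structure_def by (simp add: bounded_linear_Blinfun_apply)
qed

lemma complex_structure_sum:
  assumes "complex_structure JK" "complex_structure JH"
  shows "complex_structure (sum_structure JK JH)"
  using assms unfolding complex_structure_def
  by (auto intro!: blinfun_eqI simp: sum_structure_apply inner_prod_def blinfun.minus_left
      complex_structure_involution[OF assms(1)] complex_structure_involution[OF assms(2)])

lemma clinear_op_Rmat:
  assumes "clinear_op JK JK T" "clinear_op JH JH V" "clinear_op JH JK Y"
  shows "clinear_op (sum_structure JK JH) (sum_structure JK JH) (Rmat T V Y)"
  using assms by (simp add: clinear_op_iff Rmat_apply sum_structure_apply blinfun.add_right)

lemma Rmat_compose: "Rmat T V Y o\<^sub>L Rmat T' V' Y' = Rmat (T o\<^sub>L T') (V o\<^sub>L V') ((T o\<^sub>L Y') + (Y o\<^sub>L V'))"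
  by (rule blinfun_eqI) (simp add: Rmat_apply blinfun.add_right blinfun.add_left)

lemma Rmat_id: "Rmat id_blinfun id_blinfun 0 = id_blinfun"
  by (rule blinfun_eqI) (simp add: Rmat_apply)

lemma contraction_Rmat_zero:
  fixes T :: "'k::real_normed_vector \<Rightarrow>\<^sub>L 'k" and V :: "'h::real_normed_vector \<Rightarrow>\<^sub>L 'h"
  assumes "contraction T" "isometry V"
  shows "contraction (Rmat T V 0)"
  unfolding contraction_def
proof (rule norm_blinfun_bound)
  fix z :: "'k \<times> 'h"
  have "norm (T (fst z)) \<le> norm (fst z)"
    using norm_blinfun[of T "fst z"] assms(1) unfolding contraction_def
    by (smt (verit) mult_left_le_one_le norm_ge_zero)
  then show "norm (Rmat T V 0 z) \<le> 1 * norm z"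
    using assms(2) by (simp add: Rmat_apply norm_prod_def isometry_def power_mono)
qed simp

lemma similar_to_contraction_Rmat:
  assumes V: "clinear_op JH JH V" "isometry V" and T: "clinear_op JK JK T" "contraction T"
    and Z: "clinear_op JH JK Z" "\<And>x. Z (V x) = T (Z x) + blinfun_apply X x"
  shows "similar_to_contraction (sum_structure JK JH) (Rmat T V X)"
proof -
  let ?S = "Rmat id_blinfun id_blinfun"
  \<comment> \<open>The off-diagonal entry of the product is \<open>T Z + X - Z V\<close>, which
    vanishes by the equation for \<open>Z\<close>.\<close>
  have "?S (- Z) o\<^sub>L Rmat T V X o\<^sub>L ?S Z = Rmat T V 0"
    by (rule blinfun_eqI) (simp add: Rmat_apply Z blinfun.bilinear_simps)
  moreover have "?S Z o\<^sub>L ?S (- Z) = id_blinfun" "?S (- Z) o\<^sub>L ?S Z = id_blinfun"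
    by (rule blinfun_eqI; simp add: Rmat_apply blinfun.bilinear_simps)+
  moreover have "clinear_op JH JK (- Z)"
    using clinear_op_diff[OF clinear_op_zero Z(1)] by simp
  ultimately show ?thesis
    unfolding similar_to_contraction_def
    using contraction_Rmat_zero[OF T(2) V(2)]
    by (intro exI[of _ "?S Z"] exI[of _ "?S (- Z)"]) (auto intro: clinear_op_Rmat clinear_op_id Z(1))
qed

lemma bpow_similar:
  assumes "S o\<^sub>L Si = id_blinfun" "Si o\<^sub>L S = id_blinfun"
  shows "bpow F n = S o\<^sub>L bpow (Si o\<^sub>L F o\<^sub>L S) n o\<^sub>L Si"
proof -
  have S: "S (Si x) = x" for x
    using assms(1) by (metis blinfun_apply_blinfun_compose blinfun_apply_id_blinfun)
  show ?thesis
  proof (induction n)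
    case 0
    then show ?case using S by (auto intro!: blinfun_eqI)
  next
    case (Suc n)
    have "bpow F n x = S (bpow (Si o\<^sub>L F o\<^sub>L S) n (Si x))" for x
      by (subst Suc) simp
    then show ?case by (auto intro!: blinfun_eqI simp: bpow_Suc S)
  qed
qed

lemma norm_bpow_contraction_le: "contraction F \<Longrightarrow> norm (bpow F n) \<le> 1"
proof (induction n)
  case 0
  then show ?case by (auto intro: norm_blinfun_bound)
next
  case (Suc n)
  have "norm (bpow F (Suc n)) \<le> norm F * norm (bpow F n)"
    unfolding bpow_Suc by (rule norm_blinfun_compose)
  also have "\<dots> \<le> 1 * 1" using Suc unfolding contraction_def by (intro mult_mono) auto
  finally show ?case by simp
qed

lemma similar_to_contraction_imp_power_bounded:
  fixes F :: "'a::real_normed_vector \<Rightarrow>\<^sub>L 'a"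
  assumes "similar_to_contraction J F"
  shows "power_bounded F"
proof -
  obtain S Si :: "'a \<Rightarrow>\<^sub>L 'a"
    where S: "S o\<^sub>L Si = id_blinfun" "Si o\<^sub>L S = id_blinfun" "contraction (Si o\<^sub>L F o\<^sub>L S)"
    using assms unfolding similar_to_contraction_def by blast
  have "norm (bpow F n) \<le> norm S * 1 * norm Si" for n
    unfolding bpow_similar[OF S(1,2), of F n]
    by (intro order_trans[OF norm_blinfun_compose] mult_right_mono mult_left_mono
        norm_bpow_contraction_le S(3)) auto
  then show ?thesis unfolding power_bounded_def by blast
qed

text \<open>In the equivalent Hilbert norm \<open>norm (Si z)\<close> the block operator is a
  contraction. A shear by \<open>G\<close> makes the two summands orthogonal for this norm, so the
  squared norm splits as the dominated corner lemma requires; undoing the shear adds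
  \<open>G\<close> to the solution.\<close>

lemma intertwiner_of_similar_to_contraction:
  fixes V :: "'h::{real_inner,complete_space} \<Rightarrow>\<^sub>L 'h" and T :: "'k::{real_inner,complete_space} \<Rightarrow>\<^sub>L 'k"
  assumes JK: "complex_structure JK" and JH: "complex_structure JH"
    and V: "clinear_op JH JH V" "isometry V" and T: "clinear_op JK JK T" and X: "clinear_op JH JK X"
    and sim: "similar_to_contraction (sum_structure JK JH) (Rmat T V X)"
  shows "\<exists>Z. clinear_op JH JK Z \<and> (\<forall>x. Z (V x) = T (blinfun_apply Z x) + X x)"
proof -
  let ?J = "sum_structure JK JH"
  obtain S Si where Si: "clinear_op ?J ?J Si" and S: "S o\<^sub>L Si = id_blinfun" "Si o\<^sub>L S = id_blinfun"
    and contr: "contraction (Si o\<^sub>L Rmat T V X o\<^sub>L S)"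
    using sim unfolding similar_to_contraction_def by blast
  have SSi: "S (Si z) = z" for z
    using S(1) by (metis blinfun_apply_blinfun_compose blinfun_apply_id_blinfun)
  have Si_J: "Si (JK k, JH h) = ?J (Si (k, h))" for k h
    using Si by (simp add: clinear_op_iff) (metis sum_structure_apply fst_conv snd_conv)
  have J: "?J x \<bullet> ?J y = x \<bullet> y" for x y
    by (rule complex_structure_isometric[OF complex_structure_sum[OF JK JH]])
  have decr: "norm (Si (Rmat T V X z)) \<le> norm (Si z)" for z
  proof -
    have "norm ((Si o\<^sub>L Rmat T V X o\<^sub>L S) (Si z)) \<le> norm (Si o\<^sub>L Rmat T V X o\<^sub>L S) * norm (Si z)"
      by (rule norm_blinfun)
    also have "\<dots> \<le> 1 * norm (Si z)"
      using contr unfolding contraction_def by (intro mult_right_mono) auto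
    finally show ?thesis by (simp add: SSi)
  qed
  define a where "a k k' = Si (k, 0) \<bullet> Si (k', 0)" for k k'
  \<comment> \<open>The constant comes from \<open>norm k \<le> norm S * norm (Si (k, 0))\<close>;
    the added 1 keeps the denominator positive.\<close>
  define c where "c = 1 / ((norm S)\<^sup>2 + 1)"
  have lin: "bounded_linear (\<lambda>k. Si (k, 0))" "bounded_linear (\<lambda>h. - Si (0, h))"
    by (intro bounded_linear_intros bounded_linear_minus)+
  have a: "bounded_bilinear a" unfolding a_def
    by (rule bounded_bilinear.comp[OF bounded_bilinear_inner lin(1) lin(1)])
  have b: "bounded_bilinear (\<lambda>h k. - Si (0, h) \<bullet> Si (k, 0))"
    by (rule bounded_bilinear.comp[OF bounded_bilinear_inner lin(2) lin(1)])
  have c: "c > 0" unfolding c_def by (simp add: add_nonneg_pos)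
  have a_low: "c * (norm k)\<^sup>2 \<le> a k k" for k
  proof -
    have "norm k \<le> norm S * norm (Si (k, 0))"
      using norm_blinfun[of S "Si (k, 0)"] by (simp add: SSi)
    then have "(norm k)\<^sup>2 \<le> (norm S)\<^sup>2 * (norm (Si (k, 0)))\<^sup>2"
      by (metis norm_ge_zero power_mono power_mult_distrib)
    also have "\<dots> \<le> ((norm S)\<^sup>2 + 1) * (norm (Si (k, 0)))\<^sup>2" by (intro mult_right_mono) auto
    finally have "c * (norm k)\<^sup>2 \<le> c * (((norm S)\<^sup>2 + 1) * (norm (Si (k, 0)))\<^sup>2)"
      using c by (intro mult_left_mono) auto
    also have "\<dots> = (norm (Si (k, 0)))\<^sup>2"
      unfolding c_def using add_nonneg_pos[of "(norm S)\<^sup>2" 1] by simp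
    finally show ?thesis by (simp add: a_def power2_norm_eq_inner)
  qed
  have Si_J1: "Si (JK k, 0) = ?J (Si (k, 0))" and Si_J2: "Si (0, JH h) = ?J (Si (0, h))" for k h
    using Si_J[of k 0] Si_J[of 0 h] by simp_all
  have a_J: "a (JK x) (JK y) = a x y" for x y by (simp add: a_def Si_J1 J)
  \<comment> \<open>\<open>(G h, h)\<close> is the lift of \<open>h\<close> orthogonal to the first summand in the transported inner product.\<close>
  obtain G :: "'h \<Rightarrow>\<^sub>L 'k" where G: "\<And>h k. a (G h) k = - Si (0, h) \<bullet> Si (k, 0)"
    using coercive_form_represents_bilinear[OF a _ c a_low b] inner_commute unfolding a_def by blast
  have G_J: "clinear_op JH JK G"
    by (rule clinear_op_form_representative[OF a c a_low JK a_J _ G]) (simp add: Si_J1 Si_J2 J)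
  define y where "y h = Si (G h, h)" for h
  have y_lin: "bounded_linear y" unfolding y_def by (intro bounded_linear_intros)
  have Si_split: "Si (k, h) = Si (k - G h, 0) + y h" for k h
    unfolding y_def by (simp flip: blinfun.add_right)
  have orth: "Si (k, 0) \<bullet> y h = 0" for k h
  proof -
    have "y h = Si (G h, 0) + Si (0, h)" unfolding y_def by (simp flip: blinfun.add_right)
    then show ?thesis using G[of h k] by (simp add: a_def inner_add_right inner_commute)
  qed
  \<comment> \<open>The minimum over \<open>k\<close> is attained at \<open>k = G h\<close>, so
    \<open>y h \<bullet> y h\<close> is the squared quotient norm of \<open>h\<close>.\<close>
  have pyth: "(norm (Si (k, h)))\<^sup>2 = a (k - G h) (k - G h) + y h \<bullet> y h" for k h
    using orth[of "k - G h" h]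
    by (simp only: Si_split[of k h] power2_norm_eq_inner inner_add_left inner_add_right a_def inner_commute)
  \<comment> \<open>This is the corner of the block operator after conjugation by the shear.\<close>
  define X' where "X' = (T o\<^sub>L G) + X - (G o\<^sub>L V)"
  have "\<exists>Z. clinear_op JH JK Z \<and> (\<forall>x. Z (V x) = T (blinfun_apply Z x) + X' x)"
  proof (rule intertwiner_of_dominated_corner[OF JK JH V T])
    show "clinear_op JH JK X'" unfolding X'_def by (rule clinear_op_intros T G_J X V)+
    show "bounded_bilinear (\<lambda>h h'. y h \<bullet> y h')"
      by (rule bounded_bilinear.comp[OF bounded_bilinear_inner y_lin y_lin])
    show "y h \<bullet> y h' = y h' \<bullet> y h" for h h' by (rule inner_commute)
    show "y (JH h) \<bullet> y (JH h') = y h \<bullet> y h'" for h h'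
      using G_J by (simp add: y_def clinear_op_iff Si_J J)
    show "c > 0" by (rule c)
    show "c * (norm k)\<^sup>2 \<le> a k k" for k by (rule a_low)
    show "a 0 0 = 0" by (simp add: a_def flip: zero_prod_def)
    show "a (T k + X' h) (T k + X' h) + y (V h) \<bullet> y (V h) \<le> y h \<bullet> y h + a k k" for h k
    proof -
      have "(norm (Si (Rmat T V X (k + G h, h))))\<^sup>2 \<le> (norm (Si (k + G h, h)))\<^sup>2"
        by (intro power_mono decr) auto
      then show ?thesis
        by (simp add: Rmat_apply pyth X'_def blinfun.bilinear_simps algebra_simps)
    qed
  qed
  then obtain Z where Z: "clinear_op JH JK Z" "\<And>x. Z (V x) = T (blinfun_apply Z x) + X' x" by blast
  show ?thesis
  proof (intro exI[of _ "Z + G"] conjI allI)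
    show "clinear_op JH JK (Z + G)" by (rule clinear_op_intros Z G_J)+
    show "(Z + G) (V x) = T ((Z + G) x) + X x" for x
      by (simp add: Z X'_def blinfun.bilinear_simps)
  qed
qed

section \<open>Corners of powers\<close>

text \<open>The upper right entry of the powers of \<open>[T, A; 0, V]\<close>.\<close>

primrec corner ::
  "('k::real_normed_vector \<Rightarrow>\<^sub>L 'k) \<Rightarrow> ('h::real_normed_vector \<Rightarrow>\<^sub>L 'h) \<Rightarrow> ('h \<Rightarrow>\<^sub>L 'k) \<Rightarrow> nat \<Rightarrow> 'h \<Rightarrow>\<^sub>L 'k" where
  "corner T V A 0 = 0"
| "corner T V A (Suc n) = (T o\<^sub>L corner T V A n) + (A o\<^sub>L bpow V n)"

lemma bpow_Rmat: "bpow (Rmat T V A) n = Rmat (bpow T n) (bpow V n) (corner T V A n)"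
  by (induction n) (simp_all add: Rmat_id bpow_Suc Rmat_compose)

lemma corner_zero: "corner T V 0 n = 0"
  by (induction n) simp_all

lemma bpow_Rmat_diff: "(bpow (Rmat T V A) n - bpow (Rmat T V 0) n) (0, h) = (corner T V A n h, 0)"
  by (simp add: bpow_Rmat corner_zero Rmat_apply blinfun.diff_left)

lemma norm_corner_le: "norm (corner T V A n) \<le> norm (bpow (Rmat T V A) n)"
proof (rule norm_blinfun_bound)
  fix h
  have "norm (corner T V A n h) \<le> norm (bpow (Rmat T V A) n (0, h))"
    by (simp add: bpow_Rmat Rmat_apply norm_fst_le)
  also have "\<dots> \<le> norm (bpow (Rmat T V A) n) * norm h"
    using norm_blinfun[of _ "(0, h)"] by simp
  finally show "norm (corner T V A n h) \<le> norm (bpow (Rmat T V A) n) * norm h" .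
qed simp

text \<open>The corner of the power \<open>Suc n\<close> is the sum of the words
  \<open>T^(n-j) A V^j\<close> over \<open>j \<le> n\<close>. Those with \<open>j > 0\<close>
  evaluate \<open>A\<close> on the range of \<open>V\<close> only, so just the word with
  \<open>j = 0\<close> changes.\<close>

lemma corner_perturb:
  assumes "\<And>x. blinfun_apply X (blinfun_apply V x) = blinfun_apply A (blinfun_apply V x)"
  shows "corner T V X (Suc n) = corner T V A (Suc n) + (bpow T n o\<^sub>L (X - A))"
proof (induction n)
  case 0
  then show ?case by (auto intro!: blinfun_eqI simp: blinfun.bilinear_simps)
next
  case (Suc n)
  have "corner T V X (Suc (Suc n)) = (T o\<^sub>L corner T V X (Suc n)) + (X o\<^sub>L bpow V (Suc n))" by simp
  also have "\<dots> = (T o\<^sub>L corner T V A (Suc n)) + (A o\<^sub>L bpow V (Suc n)) + (bpow T (Suc n) o\<^sub>L (X - A))"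
    unfolding Suc by (rule blinfun_eqI) (simp add: blinfun.bilinear_simps bpow_Suc assms)
  finally show ?case by simp
qed

section \<open>The finite Wold decomposition of an isometry\<close>

locale isometry_adjoint =
  fixes V V' :: "'h::real_inner \<Rightarrow>\<^sub>L 'h"
  assumes isometry: "isometry V" and adj: "\<And>x y. V x \<bullet> y = x \<bullet> V' y"
begin

lemma left_inverse: "V' (V x) = x"
  by (metis adj isometry_inner[OF isometry] vector_eq_ldot)

text \<open>This is the orthogonal projection onto the wandering subspace
  \<open>ker V'\<close>.\<close>

definition wandering_proj where "wandering_proj = id_blinfun - (V o\<^sub>L V')"

lemma wandering_proj_apply: "wandering_proj x = x - V (V' x)"
  by (simp add: wandering_proj_def blinfun.diff_left)

lemma adj_wandering_proj: "V' (wandering_proj x) = 0"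
  by (simp add: wandering_proj_apply blinfun.diff_right left_inverse)

lemma wandering_proj_kernel: "V' x = 0 \<Longrightarrow> wandering_proj x = x"
  by (simp add: wandering_proj_apply)

lemma norm_wandering_proj: "(norm (wandering_proj x))\<^sup>2 = (norm x)\<^sup>2 - (norm (V' x))\<^sup>2"
  by (simp add: wandering_proj_apply power2_norm_eq_inner inner_diff_left inner_diff_right adj left_inverse
      inner_commute[of x "V _"])

lemma norm_wandering_proj_sum: "(\<Sum>j\<le>n. (norm (wandering_proj (bpow V' j x)))\<^sup>2) = (norm x)\<^sup>2 - (norm (bpow V' (Suc n) x))\<^sup>2"
  by (induction n) (simp_all add: norm_wandering_proj bpow_Suc)

text \<open>The summands telescope, being the differences of consecutive
  \<open>V^j V'^j x\<close>.\<close>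

lemma wold_sum: "(\<Sum>j\<le>n. bpow V j (wandering_proj (bpow V' j x))) + bpow V (Suc n) (bpow V' (Suc n) x) = x"
proof (induction n)
  case 0
  then show ?case by (simp add: wandering_proj_apply bpow_Suc)
next
  case (Suc n)
  have "bpow V (Suc n) (wandering_proj (bpow V' (Suc n) x)) + bpow V (Suc (Suc n)) (bpow V' (Suc (Suc n)) x)
      = bpow V (Suc n) (bpow V' (Suc n) x)"
    by (simp add: wandering_proj_apply blinfun.diff_right bpow_Suc_right[of V "Suc n"] bpow_Suc[of V' "Suc n"])
  then show ?case using Suc by (simp add: add.assoc)
qed

text \<open>The range of \<open>V\<close> is orthogonal to \<open>ker V'\<close>, so the term with
  \<open>j = 0\<close> splits off by Pythagoras; the rest is \<open>V\<close> applied to a shorter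
  sum of the same kind.\<close>

lemma norm_sum_bpow:
  assumes "\<And>j. j \<le> n \<Longrightarrow> V' (x j) = 0"
  shows "(norm (\<Sum>j\<le>n. bpow V j (x j)))\<^sup>2 = (\<Sum>j\<le>n. (norm (x j))\<^sup>2)"
  using assms
proof (induction n arbitrary: x)
  case 0
  then show ?case by simp
next
  case (Suc n)
  define w where "w = (\<Sum>j\<le>n. bpow V j (x (Suc j)))"
  have "(\<Sum>j\<le>Suc n. bpow V j (x j)) = x 0 + V w"
    unfolding sum.atMost_Suc_shift w_def by (simp add: bpow_Suc blinfun.sum_right)
  moreover have "V w \<bullet> x 0 = 0" using Suc.prems[of 0] by (simp add: adj)
  moreover have "(norm w)\<^sup>2 = (\<Sum>j\<le>n. (norm (x (Suc j)))\<^sup>2)"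
    unfolding w_def using Suc.prems by (intro Suc.IH) auto
  ultimately show ?case
    unfolding sum.atMost_Suc_shift
    by (simp add: power2_norm_eq_inner inner_add_left inner_add_right inner_commute[of "x 0" "V w"]
        isometry_inner[OF isometry])
qed

end

section \<open>From quadratic nearness to an intertwiner\<close>

text \<open>The Wold components of \<open>x\<close> have square sum at most
  \<open>(norm x)\<^sup>2\<close>, so \<open>near\<close> controls their contribution to
  \<open>W n x\<close>, and the uniform bound on the corners controls the remainder.\<close>

lemma intertwiner_of_quadratically_near:
  fixes V :: "'h::{real_inner,complete_space} \<Rightarrow>\<^sub>L 'h" and T :: "'k::{real_inner,complete_space} \<Rightarrow>\<^sub>L 'k"
  assumes JK: "complex_structure JK" and JH: "complex_structure JH"
    and V: "clinear_op JH JH V" "isometry V" and T: "clinear_op JK JK T" and A: "clinear_op JH JK A"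
    and adj: "\<And>x y. V x \<bullet> y = x \<bullet> blinfun_apply V' y"
    and bounded: "\<And>n. norm (corner T V A n) \<le> M"
    and near: "\<And>n x. (\<And>j. j \<le> n \<Longrightarrow> V' (x j) = 0) \<Longrightarrow>
      norm (\<Sum>j\<le>n. corner T V A j (x j)) \<le> s * sqrt (\<Sum>j\<le>n. (norm (x j))\<^sup>2)"
  shows "\<exists>Z. clinear_op JH JK Z \<and> (\<forall>x. Z (V x) = T (blinfun_apply Z x) + A x)"
proof -
  interpret isometry_adjoint V V' using V(2) adj by unfold_locales
  have V': "clinear_op JH JH V'" by (rule clinear_op_adjoint[OF JH JH V(1) adj])
  have corner_J: "clinear_op JH JK (corner T V A n)" for n
    by (induction n) (auto intro!: clinear_op_intros T A V)
  have norm_bpow_V': "norm (bpow V' (Suc n) x) \<le> norm x" for n x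
  proof -
    have "0 \<le> (\<Sum>j\<le>n. (norm (wandering_proj (bpow V' j x)))\<^sup>2)" by (intro sum_nonneg) auto
    then have "(norm (bpow V' (Suc n) x))\<^sup>2 \<le> (norm x)\<^sup>2" unfolding norm_wandering_proj_sum by simp
    then show ?thesis by (rule power2_le_imp_le) simp
  qed
  \<comment> \<open>This is the iteration \<open>W (Suc n) = (T W n + A) V'\<close> from
    \<open>W 0 = A V'\<close>, written out along the Wold decomposition.\<close>
  define W where "W n = (\<Sum>j\<le>n. corner T V A j o\<^sub>L wandering_proj o\<^sub>L bpow V' j) + (corner T V A (Suc n) o\<^sub>L bpow V' (Suc n))" for n
  have W_apply: "W n x = (\<Sum>j\<le>n. corner T V A j (wandering_proj (bpow V' j x))) + corner T V A (Suc n) (bpow V' (Suc n) x)" for n x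
    by (simp add: W_def blinfun.sum_left blinfun.add_left del: corner.simps)
  have M0: "M \<ge> 0" using bounded[of 0] by simp
  have "norm (W n) \<le> \<bar>s\<bar> + M" for n
  proof (rule norm_blinfun_bound)
    fix x
    have "norm (\<Sum>j\<le>n. corner T V A j (wandering_proj (bpow V' j x))) \<le> s * sqrt (\<Sum>j\<le>n. (norm (wandering_proj (bpow V' j x)))\<^sup>2)"
      by (rule near) (rule adj_wandering_proj)
    also have "\<dots> \<le> \<bar>s\<bar> * sqrt ((norm x)\<^sup>2)"
      unfolding norm_wandering_proj_sum using norm_bpow_V'[of n x]
      by (intro mult_mono real_sqrt_le_mono) (auto intro: power_mono)
    finally have 1: "norm (\<Sum>j\<le>n. corner T V A j (wandering_proj (bpow V' j x))) \<le> \<bar>s\<bar> * norm x" by simp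
    have "norm (corner T V A (Suc n) (bpow V' (Suc n) x)) \<le> norm (corner T V A (Suc n)) * norm (bpow V' (Suc n) x)"
      by (rule norm_blinfun)
    also have "\<dots> \<le> M * norm x" by (intro mult_mono bounded norm_bpow_V' M0) auto
    finally show "norm (W n x) \<le> (\<bar>s\<bar> + M) * norm x"
      unfolding W_apply using 1 norm_triangle_mono by (fastforce simp: distrib_right)
  qed (use M0 in simp)
  moreover have "W (Suc n) (V x) = T (W n x) + A x" for n x
  proof -
    \<comment> \<open>The summand with index 0 drops out because \<open>corner T V A 0 = 0\<close>,
      and each remaining \<open>V'\<close> power loses one factor to \<open>V\<close>.\<close>
    have "W (Suc n) (V x) = (\<Sum>j\<le>n. corner T V A (Suc j) (wandering_proj (bpow V' j x)))
        + corner T V A (Suc (Suc n)) (bpow V' (Suc n) x)"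
      unfolding W_apply sum.atMost_Suc_shift bpow_Suc_right[of V'] left_inverse by simp
    \<comment> \<open>The \<open>A\<close> parts of the corner recursion reassemble the Wold
      decomposition of \<open>x\<close>.\<close>
    also have "\<dots> = T (W n x) + A ((\<Sum>j\<le>n. bpow V j (wandering_proj (bpow V' j x))) + bpow V (Suc n) (bpow V' (Suc n) x))"
      unfolding W_apply corner.simps(2)[of _ _ _ "Suc n"] corner.simps(2)[of _ _ _ j for j]
      by (simp add: blinfun.bilinear_simps blinfun.sum_right sum.distrib)
    also have "\<dots> = T (W n x) + A x" unfolding wold_sum ..
    finally show ?thesis .
  qed
  moreover have "clinear_op JH JK (W n)" for n
    unfolding W_def wandering_proj_def by (rule clinear_op_intros corner_J V V')+
  ultimately show ?thesis by (intro intertwiner_of_bounded_iterates[of W, OF _ _ JK])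
qed

section \<open>Similarity to a contraction versus quadratic nearness\<close>

theorem theorem5p2:
  fixes JK :: "'k::{real_inner,complete_space} \<Rightarrow>\<^sub>L 'k"
    and JH :: "'h::{real_inner,complete_space} \<Rightarrow>\<^sub>L 'h"
    and V :: "'h \<Rightarrow>\<^sub>L 'h" and T :: "'k \<Rightarrow>\<^sub>L 'k" and X :: "'h \<Rightarrow>\<^sub>L 'k"
  assumes JK: "complex_structure JK" and JH: "complex_structure JH"
    and V: "clinear_op JH JH V" "isometry V"
    and T: "clinear_op JK JK T" "contraction T"
    and T_rinv: "\<exists>Tr. clinear_op JK JK Tr \<and> T o\<^sub>L Tr = id_blinfun"
    and X: "clinear_op JH JK X"
  shows "similar_to_contraction (sum_structure JK JH) (Rmat T V X) \<longleftrightarrow>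
    power_bounded (Rmat T V X) \<and>
    (\<exists>A E. clinear_op JH JK A \<and> clinear_op (sum_structure JK JH) (sum_structure JK JH) E \<and>
       nilpotent_op E \<and> E o\<^sub>L Rmat T V A = 0 \<and> Rmat T V X = Rmat T V A + E \<and>
       (\<exists>s::real. \<forall>(N::nat) (x::nat \<Rightarrow> 'k \<times> 'h).
          (\<forall>n\<le>N. x n \<in> {0} \<times> {h. adjoint (blinfun_apply V) h = 0}) \<longrightarrow>
          norm (\<Sum>n\<le>N. (bpow (Rmat T V A) n - bpow (Rmat T V 0) n) (x n))
            \<le> s * sqrt (\<Sum>n\<le>N. (norm (x n))\<^sup>2)))"
proof -
  obtain V' where adj: "\<And>x y. V x \<bullet> y = x \<bullet> blinfun_apply V' y" using blinfun_has_adjoint[of V] by blast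
  have adjoint_V: "adjoint (blinfun_apply V) = blinfun_apply V'"
    by (rule adjoint_unique) (simp add: adj)
  interpret isometry_adjoint V V' using V(2) adj by unfold_locales
  have V': "clinear_op JH JH V'" by (rule clinear_op_adjoint[OF JH JH V(1) adj])
  let ?J = "sum_structure JK JH"
  show ?thesis
  proof (intro iffI conjI)
    assume sim: "similar_to_contraction ?J (Rmat T V X)"
    then show "power_bounded (Rmat T V X)" by (rule similar_to_contraction_imp_power_bounded)
    obtain Z where Z: "clinear_op JH JK Z" "\<And>x. Z (V x) = T (blinfun_apply Z x) + X x"
      using intertwiner_of_similar_to_contraction[OF JK JH V T(1) X sim] by blast
    \<comment> \<open>The correction vanishes on the range of \<open>V\<close>, which gives
      \<open>E R(A) = 0\<close>. On \<open>ker V'\<close> it turns \<open>X\<close> into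
      \<open>X + T Z = Z V\<close>, so the corners of \<open>R(A)\<close> are plain multiples of
      \<open>Z\<close> there.\<close>
    define A where "A = X + (T o\<^sub>L Z o\<^sub>L wandering_proj)"
    define E where "E = Rmat T V X - Rmat T V A"
    have A: "clinear_op JH JK A"
      unfolding A_def wandering_proj_def by (rule clinear_op_intros X T Z V V')+
    have PV: "wandering_proj (V x) = 0" for x by (simp add: wandering_proj_apply left_inverse)
    have E_apply: "E z = (- T (Z (wandering_proj (snd z))), 0)" for z
      by (simp add: E_def Rmat_apply A_def blinfun.bilinear_simps)
    \<comment> \<open>The exponent starts at 1: the corner of the zeroth power is 0, whereas
      \<open>Z (bpow V 0 h)\<close> is \<open>Z h\<close>.\<close>
    have corner_eq: "corner T V A (Suc n) h = Z (bpow V (Suc n) h)" if "V' h = 0" for n h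
    proof (induction n)
      case 0
      then show ?case using that by (simp add: A_def blinfun.bilinear_simps wandering_proj_kernel Z bpow_Suc)
    next
      case (Suc n)
      have "corner T V A (Suc (Suc n)) h = T (corner T V A (Suc n) h) + A (bpow V (Suc n) h)"
        by (simp add: blinfun.add_left)
      also have "A (bpow V (Suc n) h) = X (bpow V (Suc n) h)"
        by (simp add: A_def blinfun.bilinear_simps bpow_Suc PV)
      finally show ?case by (simp add: Suc bpow_Suc[of V "Suc n"] Z del: corner.simps)
    qed
    have near: "norm (\<Sum>n\<le>N. (bpow (Rmat T V A) n - bpow (Rmat T V 0) n) (x n))
        \<le> norm Z * sqrt (\<Sum>n\<le>N. (norm (x n))\<^sup>2)"
      if x: "\<forall>n\<le>N. x n \<in> {0} \<times> {h. adjoint (blinfun_apply V) h = 0}" for N and x :: "nat \<Rightarrow> 'k \<times> 'h"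
    proof -
      \<comment> \<open>Setting the entry at 0 to zero accounts for the vanishing difference of
        zeroth powers.\<close>
      define h where "h n = (if n = 0 then 0 else snd (x n))" for n
      have h: "V' (h n) = 0" if "n \<le> N" for n
        using x that by (auto simp: h_def adjoint_V mem_Times_iff)
      have "(bpow (Rmat T V A) n - bpow (Rmat T V 0) n) (x n) = (Z (bpow V n (h n)), 0)" if "n \<le> N" for n
      proof -
        have xn: "x n = (0, snd (x n))" "V' (snd (x n)) = 0"
          using x that by (auto simp: adjoint_V mem_Times_iff prod_eq_iff)
        show ?thesis
        proof (cases n)
          case 0
          then show ?thesis by (simp add: h_def blinfun.diff_left zero_prod_def)
        next
          case (Suc m)
          then show ?thesis
            using bpow_Rmat_diff[of T V A n "snd (x n)"] xn corner_eq[of "snd (x n)" m] by (simp add: h_def)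
        qed
      qed
      then have "(\<Sum>n\<le>N. (bpow (Rmat T V A) n - bpow (Rmat T V 0) n) (x n)) = (Z (\<Sum>n\<le>N. bpow V n (h n)), 0)"
        by (simp add: prod_eq_iff fst_sum snd_sum blinfun.sum_right)
      then have "norm (\<Sum>n\<le>N. (bpow (Rmat T V A) n - bpow (Rmat T V 0) n) (x n))
          \<le> norm Z * norm (\<Sum>n\<le>N. bpow V n (h n))"
        by (simp add: norm_blinfun)
      \<comment> \<open>Mutual orthogonality of the spaces \<open>V^n ker V'\<close> gives the
        square sum.\<close>
      also have "norm (\<Sum>n\<le>N. bpow V n (h n)) = sqrt (\<Sum>n\<le>N. (norm (h n))\<^sup>2)"
        using norm_sum_bpow[of N h, OF h] by (metis norm_ge_zero real_sqrt_unique)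
      also have "norm Z * \<dots> \<le> norm Z * sqrt (\<Sum>n\<le>N. (norm (x n))\<^sup>2)"
        by (intro mult_left_mono real_sqrt_le_mono sum_mono power_mono) (auto simp: h_def norm_prod_def)
      finally show ?thesis .
    qed
    show "\<exists>A E. clinear_op JH JK A \<and> clinear_op ?J ?J E \<and>
       nilpotent_op E \<and> E o\<^sub>L Rmat T V A = 0 \<and> Rmat T V X = Rmat T V A + E \<and>
       (\<exists>s::real. \<forall>(N::nat) (x::nat \<Rightarrow> 'k \<times> 'h).
          (\<forall>n\<le>N. x n \<in> {0} \<times> {h. adjoint (blinfun_apply V) h = 0}) \<longrightarrow>
          norm (\<Sum>n\<le>N. (bpow (Rmat T V A) n - bpow (Rmat T V 0) n) (x n))
            \<le> s * sqrt (\<Sum>n\<le>N. (norm (x n))\<^sup>2))"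
    proof (intro exI[of _ A] exI[of _ E] conjI)
      show "clinear_op JH JK A" by (rule A)
      show "clinear_op ?J ?J E" unfolding E_def by (intro clinear_op_diff clinear_op_Rmat T V X A)
      have "bpow E 2 = 0"
        by (rule blinfun_eqI) (simp add: numeral_2_eq_2 bpow_Suc E_apply zero_prod_def)
      then show "nilpotent_op E" unfolding nilpotent_op_def by blast
      show "E o\<^sub>L Rmat T V A = 0"
        by (rule blinfun_eqI) (simp add: E_apply Rmat_apply PV zero_prod_def)
      show "Rmat T V X = Rmat T V A + E" by (simp add: E_def)
      show "\<exists>s::real. \<forall>(N::nat) (x::nat \<Rightarrow> 'k \<times> 'h).
          (\<forall>n\<le>N. x n \<in> {0} \<times> {h. adjoint (blinfun_apply V) h = 0}) \<longrightarrow>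
          norm (\<Sum>n\<le>N. (bpow (Rmat T V A) n - bpow (Rmat T V 0) n) (x n))
            \<le> s * sqrt (\<Sum>n\<le>N. (norm (x n))\<^sup>2)"
        using near by blast
    qed
  next
    assume "power_bounded (Rmat T V X) \<and>
      (\<exists>A E. clinear_op JH JK A \<and> clinear_op ?J ?J E \<and>
         nilpotent_op E \<and> E o\<^sub>L Rmat T V A = 0 \<and> Rmat T V X = Rmat T V A + E \<and>
         (\<exists>s::real. \<forall>(N::nat) (x::nat \<Rightarrow> 'k \<times> 'h).
            (\<forall>n\<le>N. x n \<in> {0} \<times> {h. adjoint (blinfun_apply V) h = 0}) \<longrightarrow>
            norm (\<Sum>n\<le>N. (bpow (Rmat T V A) n - bpow (Rmat T V 0) n) (x n))
              \<le> s * sqrt (\<Sum>n\<le>N. (norm (x n))\<^sup>2)))"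
    then obtain A E s where pb: "power_bounded (Rmat T V X)" and A: "clinear_op JH JK A"
      and EA: "E o\<^sub>L Rmat T V A = 0" and E: "Rmat T V X = Rmat T V A + E"
      and near: "\<forall>N (x :: nat \<Rightarrow> 'k \<times> 'h).
          (\<forall>n\<le>N. x n \<in> {0} \<times> {h. adjoint (blinfun_apply V) h = 0}) \<longrightarrow>
          norm (\<Sum>n\<le>N. (bpow (Rmat T V A) n - bpow (Rmat T V 0) n) (x n))
            \<le> s * sqrt (\<Sum>n\<le>N. (norm (x n))\<^sup>2)"
      by (elim conjE exE)
    \<comment> \<open>The second coordinate of \<open>R(A) (0, x)\<close> is \<open>V x\<close>, and
      \<open>E\<close> acts by \<open>X - A\<close> on that coordinate.\<close>
    have XA: "X (V x) = A (V x)" for x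
    proof -
      have "E (Rmat T V A (0, x)) = 0" by (metis EA blinfun_apply_blinfun_compose blinfun.zero_left)
      moreover have "E = Rmat T V X - Rmat T V A" by (simp add: E)
      ultimately show ?thesis by (simp add: Rmat_apply blinfun.diff_left zero_prod_def)
    qed
    obtain M where M: "\<And>n. norm (bpow (Rmat T V X) n) \<le> M" using pb unfolding power_bounded_def by blast
    have M0: "0 \<le> M" using M[of 0] norm_ge_zero order_trans by blast
    \<comment> \<open>Power boundedness is given for \<open>R(X)\<close>; passing to
      \<open>R(A)\<close> costs one term \<open>T^m (X - A)\<close>, bounded because
      \<open>T\<close> is a contraction.\<close>
    have corner_bounded: "norm (corner T V A n) \<le> M + norm (X - A)" for n
    proof (cases n)
      case 0
      then show ?thesis using M0 by simp
    next
      case (Suc m)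
      have "corner T V A n = corner T V X n - (bpow T m o\<^sub>L (X - A))"
        unfolding Suc corner_perturb[of X V A, OF XA] by simp
      also have "norm \<dots> \<le> norm (corner T V X n) + norm (bpow T m o\<^sub>L (X - A))" by (rule norm_triangle_ineq4)
      also have "\<dots> \<le> M + 1 * norm (X - A)"
        by (intro add_mono order_trans[OF norm_corner_le M] order_trans[OF norm_blinfun_compose]
            mult_right_mono norm_bpow_contraction_le T) auto
      finally show ?thesis by simp
    qed
    have corner_near: "norm (\<Sum>j\<le>n. corner T V A j (x j)) \<le> s * sqrt (\<Sum>j\<le>n. (norm (x j))\<^sup>2)"
      if "\<And>j. j \<le> n \<Longrightarrow> V' (x j) = 0" for n and x :: "nat \<Rightarrow> 'h"
    proof -
      have "(\<Sum>j\<le>n. (bpow (Rmat T V A) j - bpow (Rmat T V 0) j) (0, x j)) = (\<Sum>j\<le>n. corner T V A j (x j), 0)"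
        by (simp add: bpow_Rmat_diff prod_eq_iff fst_sum snd_sum)
      then show ?thesis using near[rule_format, of n "\<lambda>j. (0, x j)"] that by (simp add: adjoint_V)
    qed
    obtain Z where Z: "clinear_op JH JK Z" "\<And>x. Z (V x) = T (blinfun_apply Z x) + A x"
      using intertwiner_of_quadratically_near[OF JK JH V T(1) A adj corner_bounded corner_near] by blast
    obtain Tr where Tr: "clinear_op JK JK Tr" "T o\<^sub>L Tr = id_blinfun" using T_rinv by blast
    have TTr: "T (Tr x) = x" for x
      using Tr(2) by (metis blinfun_apply_blinfun_compose blinfun_apply_id_blinfun)
    show "similar_to_contraction ?J (Rmat T V X)"
    proof (rule similar_to_contraction_Rmat[OF V T])
      \<comment> \<open>The correction vanishes on the range of \<open>V\<close>, while applying
        \<open>T\<close> to it gives exactly \<open>X - A\<close>; hence it exchanges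
        \<open>A\<close> for \<open>X\<close> in the equation.\<close>
      show "clinear_op JH JK (Z - (Tr o\<^sub>L (X - A)))" by (rule clinear_op_intros Z Tr X A)+
      show "(Z - (Tr o\<^sub>L (X - A))) (V x) = T ((Z - (Tr o\<^sub>L (X - A))) x) + X x" for x
        by (simp add: blinfun.bilinear_simps Z XA TTr)
    qed
  qed
qed

end
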